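(* Let $\mathcal{NS}$ be the Neveu-Schwarz algebra, $\lambda\in\mathbb{C}^*$ and $\alpha\in\mathbb{C}$. Then the $\mathcal{NS}$-module $\Omega_{\mathcal{NS}}(\lambda,\alpha)$ is simple if and only if $\alpha\neq 0$.
   Context: All spaces are over $\mathbb{C}$; $\mathbb{C}^*$ is the set of nonzero complex numbers. The Neveu-Schwarz algebra $\mathcal{NS}$ is the Lie superalgebra whose even part has basis $\{L_n\mid n\in\mathbb{Z}\}$ and whose odd part has basis $\{G_r\mid r\in\frac12+\mathbb{Z}\}$, with brackets $[L_m,L_n]=(m-n)L_{m+n}$, $[L_m,G_r]=(\frac m2-r)G_{m+r}$, $[G_r,G_s]=2L_{r+s}$. A module over a Lie superalgebra $A$ always means a supermodule $M=M_{\bar 0}\oplus M_{\bar 1}$ with $A_{\bar i}\cdot M_{\bar j}\subseteq M_{\bar i+\bar j}$; submodules are $\mathbb{Z}_2$-graded. For $\lambda\in\mathbb{C}^*$, $\alpha\in\mathbb{C}$, $\Omega_{\mathcal{NS}}(\lambda,\alpha)$ is the $\mathcal{NS}$-module with underlying space $\mathbb{C}[x]\oplus\mathbb{C}[y]$ (part $\bar 0$ is $\mathbb{C}[x]$, part $\bar 1$ is $\mathbb{C}[y]$) and action, for $m\in\mathbb{Z}$, $r\in\frac12+\mathbb{Z}$, $f(x)\in\mathbb{C}[x]$, $g(y)\in\mathbb{C}[y]$: $L_mf(x)=\lambda^m(x+m\alpha)f(x+m)$, $L_mg(y)=\lambda^m(y+m(\alpha+\frac12))g(y+m)$, $G_rf(x)=\lambda^{r-\frac12}f(y+r)$,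 $G_rg(y)=\lambda^{r+\frac12}(x+2r\alpha)g(x+r)$. *)

theory Defs
  imports
    Complex_Main
    "HOL-Library.Z2"
    "HOL-Library.Product_Plus"
    "HOL-Library.Poly_Mapping"
    "HOL-Computational_Algebra.Polynomial"
begin

section \<open>Lie superalgebras and supermodules\<close>

locale superspace = vector_space scale
  for scale :: "'k::field \<Rightarrow> 'v::ab_group_add \<Rightarrow> 'v" +
  fixes part :: "bit \<Rightarrow> 'v set"
  assumes part_subspace: "subspace (part i)"
    and part_disjoint: "part 0 \<inter> part 1 = {0}"
    and part_spans: "\<exists>u \<in> part 0. \<exists>w \<in> part 1. v = u + w"

definition bilinear_map ::
  "('k::field \<Rightarrow> 'a::ab_group_add \<Rightarrow> 'a) \<Rightarrow> ('k \<Rightarrow> 'b::ab_group_add \<Rightarrow> 'b) \<Rightarrow>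
   ('k \<Rightarrow> 'c::ab_group_add \<Rightarrow> 'c) \<Rightarrow> ('a \<Rightarrow> 'b \<Rightarrow> 'c) \<Rightarrow> bool" where
  "bilinear_map sA sB sC h \<longleftrightarrow>
     (\<forall>x. Vector_Spaces.linear sB sC (h x)) \<and> (\<forall>y. Vector_Spaces.linear sA sC (\<lambda>x. h x y))"

text \<open>The sign \<open>(-1)\<^sup>i\<^sup>j\<close>.\<close>

definition koszul :: "bit \<Rightarrow> bit \<Rightarrow> 'k::field" where
  "koszul i j = (if i = 1 \<and> j = 1 then - 1 else 1)"

locale lie_superalgebra = superspace sA partA
  for sA :: "'k::field \<Rightarrow> 'a::ab_group_add \<Rightarrow> 'a" and partA :: "bit \<Rightarrow> 'a set" +
  fixes bracket :: "'a \<Rightarrow> 'a \<Rightarrow> 'a"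
  assumes bracket_bilinear: "bilinear_map sA sA sA bracket"
    and bracket_part: "\<lbrakk>x \<in> partA i; y \<in> partA j\<rbrakk> \<Longrightarrow> bracket x y \<in> partA (i + j)"
    and bracket_skew: "\<lbrakk>x \<in> partA i; y \<in> partA j\<rbrakk> \<Longrightarrow>
      bracket x y = - sA (koszul i j) (bracket y x)"
    and bracket_jacobi: "\<lbrakk>x \<in> partA i; y \<in> partA j; z \<in> partA k\<rbrakk> \<Longrightarrow>
      bracket x (bracket y z) =
        bracket (bracket x y) z + sA (koszul i j) (bracket y (bracket x z))"

locale lie_supermodule =
  lie_superalgebra sA partA bracket + M: superspace sM partM
  for sA :: "'k::field \<Rightarrow> 'a::ab_group_add \<Rightarrow> 'a" and partA :: "bit \<Rightarrow> 'a set"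
    and bracket :: "'a \<Rightarrow> 'a \<Rightarrow> 'a"
    and sM :: "'k \<Rightarrow> 'm::ab_group_add \<Rightarrow> 'm" and partM :: "bit \<Rightarrow> 'm set" +
  fixes act :: "'a \<Rightarrow> 'm \<Rightarrow> 'm"
  assumes act_bilinear: "bilinear_map sA sM sM act"
    and act_part: "\<lbrakk>x \<in> partA i; v \<in> partM j\<rbrakk> \<Longrightarrow> act x v \<in> partM (i + j)"
    and act_bracket: "\<lbrakk>x \<in> partA i; y \<in> partA j\<rbrakk> \<Longrightarrow>
      act (bracket x y) v = act x (act y v) - sM (koszul i j) (act y (act x v))"

definition lie_subsupermodule ::
  "('k::field \<Rightarrow> 'm::ab_group_add \<Rightarrow> 'm) \<Rightarrow> (bit \<Rightarrow> 'm set) \<Rightarrow> ('a \<Rightarrow> 'm \<Rightarrow> 'm) \<Rightarrow> 'm set \<Rightarrow> bool" where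
  "lie_subsupermodule sM partM act N \<longleftrightarrow>
     module.subspace sM N \<and>
     (\<forall>v\<in>N. \<exists>u \<in> N \<inter> partM 0. \<exists>w \<in> N \<inter> partM 1. v = u + w) \<and>
     (\<forall>x. \<forall>v\<in>N. act x v \<in> N)"

definition simple_lie_supermodule ::
  "('k::field \<Rightarrow> 'a::ab_group_add \<Rightarrow> 'a) \<Rightarrow> (bit \<Rightarrow> 'a set) \<Rightarrow> ('a \<Rightarrow> 'a \<Rightarrow> 'a) \<Rightarrow>
   ('k \<Rightarrow> 'm::ab_group_add \<Rightarrow> 'm) \<Rightarrow> (bit \<Rightarrow> 'm set) \<Rightarrow> ('a \<Rightarrow> 'm \<Rightarrow> 'm) \<Rightarrow> bool" where
  "simple_lie_supermodule sA partA bracket sM partM act \<longleftrightarrow>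
     lie_supermodule sA partA bracket sM partM act \<and>
     (\<exists>v::'m. v \<noteq> 0) \<and>
     (\<forall>N. lie_subsupermodule sM partM act N \<longrightarrow> N = {0} \<or> N = UNIV)"


section \<open>The Neveu-Schwarz algebra\<close>

text \<open>
  The odd generators are indexed by half-integers; \<open>NS_G k\<close> stands for \<open>G\<^sub>r\<close> with \<open>r = k + 1/2\<close>.
  The algebra is the space of finitely supported functions on the generators.
\<close>

datatype ns_gen = NS_L int | NS_G int

type_synonym ns = "ns_gen \<Rightarrow>\<^sub>0 complex"

definition half_int :: "int \<Rightarrow> complex" where
  "half_int k = of_int k + 1 / 2"

fun ns_parity :: "ns_gen \<Rightarrow> bit" where
  "ns_parity (NS_L m) = 0"
| "ns_parity (NS_G k) = 1"

definition ns_scale :: "complex \<Rightarrow> ns \<Rightarrow> ns" where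
  "ns_scale c = Poly_Mapping.map ((*) c)"

definition ns_part :: "bit \<Rightarrow> ns set" where
  "ns_part i = {a. \<forall>b \<in> Poly_Mapping.keys a. ns_parity b = i}"

definition ns_extend :: "(complex \<Rightarrow> 'v::ab_group_add \<Rightarrow> 'v) \<Rightarrow> (ns_gen \<Rightarrow> 'v) \<Rightarrow> ns \<Rightarrow> 'v" where
  "ns_extend s f a = (\<Sum>b \<in> Poly_Mapping.keys a. s (Poly_Mapping.lookup a b) (f b))"

text \<open>
  In the last equation, \<open>(k + 1/2) + (l + 1/2) = k + l + 1\<close>.
\<close>

fun ns_gen_bracket :: "ns_gen \<Rightarrow> ns_gen \<Rightarrow> ns" where
  "ns_gen_bracket (NS_L m) (NS_L n) = Poly_Mapping.single (NS_L (m + n)) (of_int m - of_int n)"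
| "ns_gen_bracket (NS_L m) (NS_G k) = Poly_Mapping.single (NS_G (m + k)) (of_int m / 2 - half_int k)"
| "ns_gen_bracket (NS_G k) (NS_L m) = - Poly_Mapping.single (NS_G (m + k)) (of_int m / 2 - half_int k)"
| "ns_gen_bracket (NS_G k) (NS_G l) = Poly_Mapping.single (NS_L (k + l + 1)) 2"

definition ns_bracket :: "ns \<Rightarrow> ns \<Rightarrow> ns" where
  "ns_bracket a b = ns_extend ns_scale (\<lambda>i. ns_extend ns_scale (ns_gen_bracket i) b) a"


section \<open>The modules \<open>\<Omega>(\<lambda>, \<alpha>)\<close>\<close>

text \<open>
  \<open>(f, g)\<close> stands for \<open>f(x) + g(y)\<close>. The factor \<open>[:c, 1:]\<close> is the polynomial \<open>x + c\<close> (or \<open>y + c\<close>),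
  and \<open>poly_translate c f\<close> is \<open>f(x + c)\<close>. With \<open>r = k + 1/2\<close>, the exponents \<open>r - 1/2\<close> and \<open>r + 1/2\<close>
  are \<open>k\<close> and \<open>k + 1\<close>.
\<close>

type_synonym omega = "complex poly \<times> complex poly"

definition omega_scale :: "complex \<Rightarrow> omega \<Rightarrow> omega" where
  "omega_scale c v = (smult c (fst v), smult c (snd v))"

definition omega_part :: "bit \<Rightarrow> omega set" where
  "omega_part i = (if i = 0 then {v. snd v = 0} else {v. fst v = 0})"

definition poly_translate :: "complex \<Rightarrow> complex poly \<Rightarrow> complex poly" where
  "poly_translate c f = f \<circ>\<^sub>p [:c, 1:]"

fun omega_gen_act :: "complex \<Rightarrow> complex \<Rightarrow> ns_gen \<Rightarrow> omega \<Rightarrow> omega" where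
  "omega_gen_act lam \<alpha> (NS_L m) (f, g) =
     (smult (lam powi m) ([:of_int m * \<alpha>, 1:] * poly_translate (of_int m) f),
      smult (lam powi m) ([:of_int m * (\<alpha> + 1 / 2), 1:] * poly_translate (of_int m) g))"
| "omega_gen_act lam \<alpha> (NS_G k) (f, g) =
     (smult (lam powi (k + 1)) ([:2 * half_int k * \<alpha>, 1:] * poly_translate (half_int k) g),
      smult (lam powi k) (poly_translate (half_int k) f))"

definition omega_act :: "complex \<Rightarrow> complex \<Rightarrow> ns \<Rightarrow> omega \<Rightarrow> omega" where
  "omega_act lam \<alpha> a v = ns_extend omega_scale (\<lambda>b. omega_gen_act lam \<alpha> b v) a"


section \<open>Well-definedness\<close>

lemma lookup_ns_scale [simp]: "Poly_Mapping.lookup (ns_scale c a) b = c * Poly_Mapping.lookup a b"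
  by (simp add: ns_scale_def Poly_Mapping.map.rep_eq when_def)

lemma ns_scale_single [simp]:
  "ns_scale c (Poly_Mapping.single b d) = Poly_Mapping.single b (c * d)"
  by (rule poly_mapping_eqI) (simp add: lookup_single when_def)

lemma vector_space_ns: "vector_space ns_scale"
  by unfold_locales (auto intro!: poly_mapping_eqI simp: lookup_add algebra_simps)

lemma vector_space_omega: "vector_space omega_scale"
  by unfold_locales (auto simp: omega_scale_def smult_add_right smult_add_left)

lemma ns_extend_superset:
  assumes "vector_space s" "finite S" "Poly_Mapping.keys a \<subseteq> S"
  shows "ns_extend s f a = (\<Sum>b\<in>S. s (Poly_Mapping.lookup a b) (f b))"
proof -
  interpret vector_space s by fact
  show ?thesis
    unfolding ns_extend_def
    by (rule sum.mono_neutral_left) (use assms in \<open>auto simp: in_keys_iff\<close>)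
qed

lemma ns_extend_add:
  assumes "vector_space s"
  shows "ns_extend s f (a + b) = ns_extend s f a + ns_extend s f b"
proof -
  interpret vector_space s by fact
  let ?S = "Poly_Mapping.keys a \<union> Poly_Mapping.keys b"
  have "Poly_Mapping.keys (a + b) \<subseteq> ?S" by (rule keys_add)
  then show ?thesis
    using assms by (simp add: ns_extend_superset[of s ?S] lookup_add scale_left_distrib sum.distrib)
qed

lemma ns_extend_scale:
  assumes "vector_space s"
  shows "ns_extend s f (ns_scale c a) = s c (ns_extend s f a)"
proof -
  interpret vector_space s by fact
  have "Poly_Mapping.keys (ns_scale c a) \<subseteq> Poly_Mapping.keys a"
    by (auto simp: in_keys_iff)
  then show ?thesis
    using assms
    by (simp add: ns_extend_superset[of s "Poly_Mapping.keys a"] scale_sum_right)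
qed

lemma ns_extend_single:
  assumes "vector_space s"
  shows "ns_extend s f (Poly_Mapping.single b c) = s c (f b)"
proof -
  interpret vector_space s by fact
  show ?thesis by (simp add: ns_extend_def)
qed

lemma ns_extend_linear:
  assumes "vector_space s"
  shows "Vector_Spaces.linear ns_scale s (ns_extend s f)"
  using assms by (simp add: Vector_Spaces.linear_iff vector_space_ns ns_extend_add ns_extend_scale)

lemma ns_extend_fun_add:
  assumes "vector_space s"
  shows "ns_extend s (\<lambda>b. f b + g b) a = ns_extend s f a + ns_extend s g a"
proof -
  interpret vector_space s by fact
  show ?thesis by (simp add: ns_extend_def scale_right_distrib sum.distrib)
qed

lemma ns_extend_fun_scale:
  assumes "vector_space s"
  shows "ns_extend s (\<lambda>b. s c (f b)) a = s c (ns_extend s f a)"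
proof -
  interpret vector_space s by fact
  show ?thesis by (simp add: ns_extend_def scale_sum_right mult.commute)
qed

lemma bilinear_ns_bracket: "bilinear_map ns_scale ns_scale ns_scale ns_bracket"
  by (auto simp: bilinear_map_def Vector_Spaces.linear_iff vector_space_ns ns_bracket_def
      ns_extend_add ns_extend_scale ns_extend_fun_add ns_extend_fun_scale[OF vector_space_ns])

lemma omega_gen_act_add:
  "omega_gen_act lam \<alpha> b (v + w) = omega_gen_act lam \<alpha> b v + omega_gen_act lam \<alpha> b w"
  by (cases b; cases v; cases w)
    (simp_all add: poly_translate_def pcompose_add smult_add_right distrib_left del: mult_pCons_left)

lemma omega_gen_act_scale:
  "omega_gen_act lam \<alpha> b (omega_scale c v) = omega_scale c (omega_gen_act lam \<alpha> b v)"
  by (cases b; cases v)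
    (simp_all add: omega_scale_def poly_translate_def pcompose_smult poly_eq_poly_eq_iff[symmetric]
      fun_eq_iff algebra_simps)

lemma bilinear_omega_act: "bilinear_map ns_scale omega_scale omega_scale (omega_act lam \<alpha>)"
  by (auto simp: bilinear_map_def Vector_Spaces.linear_iff vector_space_ns vector_space_omega omega_act_def
      ns_extend_add ns_extend_scale ns_extend_fun_add ns_extend_fun_scale[OF vector_space_omega]
      omega_gen_act_add omega_gen_act_scale)

lemma ns_expand: "a = (\<Sum>b\<in>Poly_Mapping.keys a. Poly_Mapping.single b (Poly_Mapping.lookup a b))"
  by (rule poly_mapping_eqI)
    (simp add: lookup_sum lookup_single when_def in_keys_iff)

lemma ns_part_induct [consumes 1, case_names zero add scale gen]:
  assumes a: "a \<in> ns_part i"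
    and zero: "P 0"
    and add: "\<And>x y. P x \<Longrightarrow> P y \<Longrightarrow> P (x + y)"
    and scale: "\<And>c x. P x \<Longrightarrow> P (ns_scale c x)"
    and gen: "\<And>b. ns_parity b = i \<Longrightarrow> P (Poly_Mapping.single b 1)"
  shows "P a"
proof -
  have *: "P (\<Sum>b\<in>S. Poly_Mapping.single b (Poly_Mapping.lookup a b))"
    if "finite S" "S \<subseteq> Poly_Mapping.keys a" for S
    using that
  proof (induction S)
    case empty
    then show ?case by (simp add: zero)
  next
    case (insert b S)
    then have "ns_parity b = i" using a by (auto simp: ns_part_def)
    from scale[OF gen[OF this], of "Poly_Mapping.lookup a b"] insert add
    show ?case by simp
  qed
  from *[of "Poly_Mapping.keys a"] show ?thesis by (simp flip: ns_expand)
qed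

lemma superspace_ns: "superspace ns_scale ns_part"
proof -
  interpret vector_space ns_scale by (rule vector_space_ns)
  show ?thesis
  proof
    fix i
    show "subspace (ns_part i)"
      unfolding subspace_def ns_part_def using keys_add
      by (fastforce simp: in_keys_iff)
  next
    show "ns_part 0 \<inter> ns_part 1 = {0}"
      by (fastforce simp: ns_part_def simp flip: keys_eq_empty)
  next
    fix v :: ns
    let ?f = "\<lambda>i. \<Sum>b\<in>{b \<in> Poly_Mapping.keys v. ns_parity b = i}.
      Poly_Mapping.single b (Poly_Mapping.lookup v b)"
    have l: "Poly_Mapping.lookup (?f i) b = (if ns_parity b = i then Poly_Mapping.lookup v b else 0)"
      for i b by (auto simp: lookup_sum lookup_single when_def in_keys_iff)
    have "?f i \<in> ns_part i" for i
      unfolding ns_part_def mem_Collect_eq by (metis l in_keys_iff)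
    moreover have "v = ?f 0 + ?f 1"
      by (rule poly_mapping_eqI) (simp add: l lookup_add)
    ultimately show "\<exists>u\<in>ns_part 0. \<exists>w\<in>ns_part 1. v = u + w" by blast
  qed
qed

lemma superspace_omega: "superspace omega_scale omega_part"
proof -
  interpret vector_space omega_scale by (rule vector_space_omega)
  show ?thesis
  proof
    fix i
    show "subspace (omega_part i)"
      by (auto simp: subspace_def omega_part_def omega_scale_def)
  next
    show "omega_part 0 \<inter> omega_part 1 = {0}"
      by (auto simp: omega_part_def prod_eq_iff)
  next
    fix v :: omega
    have "v = (fst v, 0) + (0, snd v)" by simp
    then show "\<exists>u\<in>omega_part 0. \<exists>w\<in>omega_part 1. v = u + w"
      by (auto simp: omega_part_def intro!: bexI[of _ "(fst v, 0)"] bexI[of _ "(0, snd v)"])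
  qed
qed

lemma ns_bracket_linear [simp]:
  "ns_bracket (a + b) c = ns_bracket a c + ns_bracket b c"
  "ns_bracket c (a + b) = ns_bracket c a + ns_bracket c b"
  "ns_bracket (ns_scale k a) c = ns_scale k (ns_bracket a c)"
  "ns_bracket c (ns_scale k a) = ns_scale k (ns_bracket c a)"
  using bilinear_ns_bracket by (auto simp: bilinear_map_def Vector_Spaces.linear_iff)

lemma omega_act_linear [simp]:
  "omega_act lam \<alpha> (a + b) v = omega_act lam \<alpha> a v + omega_act lam \<alpha> b v"
  "omega_act lam \<alpha> a (v + w) = omega_act lam \<alpha> a v + omega_act lam \<alpha> a w"
  "omega_act lam \<alpha> (ns_scale k a) v = omega_scale k (omega_act lam \<alpha> a v)"
  "omega_act lam \<alpha> a (omega_scale k v) = omega_scale k (omega_act lam \<alpha> a v)"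
  using bilinear_omega_act[of lam \<alpha>] unfolding bilinear_map_def Vector_Spaces.linear_iff by blast+

lemma ns_bracket_zero [simp]: "ns_bracket 0 a = 0" "ns_bracket a 0 = 0"
  using ns_bracket_linear(1)[of 0 0 a] ns_bracket_linear(2)[of a 0 0] by simp_all

lemma omega_act_zero [simp]: "omega_act lam \<alpha> 0 v = 0" "omega_act lam \<alpha> a 0 = 0"
  using omega_act_linear(1)[of lam \<alpha> 0 0 v] omega_act_linear(2)[of lam \<alpha> a 0 0] by simp_all

lemma ns_bracket_single [simp]:
  "ns_bracket (Poly_Mapping.single a c) (Poly_Mapping.single b d) =
     ns_scale (c * d) (ns_gen_bracket a b)"
  by (simp add: ns_bracket_def ns_extend_single vector_space_ns
      vector_space.vector_space_assms(3)[OF vector_space_ns])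

lemma omega_act_single [simp]:
  "omega_act lam \<alpha> (Poly_Mapping.single a c) v = omega_scale c (omega_gen_act lam \<alpha> a v)"
  by (simp add: omega_act_def ns_extend_single vector_space_omega)

lemma ns_bracket_minus_single [simp]:
  "ns_scale c (- a) = - ns_scale c a"
  "ns_bracket a (- b) = - ns_bracket a b"
  "ns_bracket (- a) b = - ns_bracket a b"
proof -
  interpret vector_space ns_scale by (rule vector_space_ns)
  show "ns_scale c (- a) = - ns_scale c a" by simp
  show "ns_bracket a (- b) = - ns_bracket a b"
    using ns_bracket_linear(4)[of a "-1" b] by simp
  show "ns_bracket (- a) b = - ns_bracket a b"
    using ns_bracket_linear(3)[of "-1" a b] by simp
qed

lemma omega_act_minus [simp]: "omega_act lam \<alpha> (- a) v = - omega_act lam \<alpha> a v"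
proof -
  have "omega_act lam \<alpha> a v + omega_act lam \<alpha> (- a) v = 0"
    by (simp flip: omega_act_linear(1))
  then show ?thesis by (simp add: eq_neg_iff_add_eq_0 add.commute)
qed

lemma single_eqI: "x = y \<Longrightarrow> c = d \<Longrightarrow> Poly_Mapping.single x c = Poly_Mapping.single y d"
  by simp

lemma lie_superalgebra_ns: "lie_superalgebra ns_scale ns_part ns_bracket"
proof -
  interpret superspace ns_scale ns_part by (rule superspace_ns)
  show ?thesis
  proof
    show "bilinear_map ns_scale ns_scale ns_scale ns_bracket" by (rule bilinear_ns_bracket)
  next
    fix x y :: ns and i j
    assume x: "x \<in> ns_part i" and y: "y \<in> ns_part j"
    from x show "ns_bracket x y \<in> ns_part (i + j)"
    proof (induction rule: ns_part_induct)
      case (gen a)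
      from y show ?case
      proof (induction rule: ns_part_induct)
        case (gen b)
        with \<open>ns_parity a = i\<close> show ?case
          by (cases a; cases b) (auto simp: ns_part_def)
      qed (auto intro: subspace_add subspace_scale subspace_0 part_subspace)
    qed (auto intro: subspace_add subspace_scale subspace_0 part_subspace)
    from x show "ns_bracket x y = - ns_scale (koszul i j) (ns_bracket y x)"
    proof (induction rule: ns_part_induct)
      case (gen a)
      from y show ?case
      proof (induction rule: ns_part_induct)
        case (gen b)
        with \<open>ns_parity a = i\<close> show ?case
          by (cases a; cases b)
            (auto simp: koszul_def single_uminus[symmetric] intro!: single_eqI)
      qed (auto simp: scale_right_distrib mult.commute)
    qed (auto simp: scale_right_distrib mult.commute)
  next
    fix x y z :: ns and i j k
    assume x: "x \<in> ns_part i" and y: "y \<in> ns_part j" and z: "z \<in> ns_part k"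
    from x show "ns_bracket x (ns_bracket y z) =
      ns_bracket (ns_bracket x y) z + ns_scale (koszul i j) (ns_bracket y (ns_bracket x z))"
    proof (induction rule: ns_part_induct)
      case (gen a)
      from y show ?case
      proof (induction rule: ns_part_induct)
        case (gen b)
        from z show ?case
        proof (induction rule: ns_part_induct)
          case (gen c)
          with \<open>ns_parity a = i\<close> \<open>ns_parity b = j\<close> show ?case
            by (cases a; cases b; cases c)
              (auto simp: koszul_def half_int_def add_ac field_simps
                simp flip: single_uminus single_add single_diff intro!: single_eqI)
        qed (auto simp: scale_right_distrib mult.commute)
      qed (auto simp: scale_right_distrib mult.commute)
    qed (auto simp: scale_right_distrib mult.commute)
  qed
qed

lemma lie_supermodule_omega:
  assumes "lam \<noteq> 0"
  shows "lie_supermodule ns_scale ns_part ns_bracket omega_scale omega_part (omega_act lam \<alpha>)"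
proof -
  interpret lie_superalgebra ns_scale ns_part ns_bracket by (rule lie_superalgebra_ns)
  interpret M: superspace omega_scale omega_part by (rule superspace_omega)
  show ?thesis
  proof
    show "bilinear_map ns_scale omega_scale omega_scale (omega_act lam \<alpha>)"
      by (rule bilinear_omega_act)
  next
    fix x :: ns and v :: omega and i j
    assume x: "x \<in> ns_part i" and v: "v \<in> omega_part j"
    from x show "omega_act lam \<alpha> x v \<in> omega_part (i + j)"
    proof (induction rule: ns_part_induct)
      case (gen a)
      with v show ?case
        by (cases a; cases v; cases i; cases j) (auto simp: omega_part_def omega_scale_def poly_translate_def)
    qed (auto intro: M.subspace_add M.subspace_scale M.subspace_0 M.part_subspace)
  next
    fix x y :: ns and v :: omega and i j
    assume x: "x \<in> ns_part i" and y: "y \<in> ns_part j"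
    from x show "omega_act lam \<alpha> (ns_bracket x y) v =
      omega_act lam \<alpha> x (omega_act lam \<alpha> y v)
      - omega_scale (koszul i j) (omega_act lam \<alpha> y (omega_act lam \<alpha> x v))"
    proof (induction rule: ns_part_induct)
      case (gen a)
      from y show ?case
      proof (induction rule: ns_part_induct)
        case (gen b)
        obtain f g where v: "v = (f, g)" by (cases v)
        from gen \<open>ns_parity a = i\<close> assms show ?case unfolding v
          by (cases a; cases b;
              clarsimp simp: koszul_def half_int_def omega_scale_def poly_translate_def
                poly_eq_poly_eq_iff[symmetric] poly_pcompose fun_eq_iff power_int_add;
              (intro conjI allI)?;
              simp add: algebra_simps; (algebra | simp add: field_simps)?)
      qed (auto simp: M.scale_right_distrib M.scale_right_diff_distrib mult.commute)
    qed (auto simp: M.scale_right_distrib M.scale_right_diff_distrib mult.commute)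
  qed
qed

end

theory Submission
  imports Defs
begin

text \<open>
  If \<open>\<alpha> = 0\<close>, then \<open>x\<complex>[x] \<oplus> \<complex>[y]\<close> is a proper nonzero submodule. If \<open>\<alpha> \<noteq> 0\<close>, let \<open>N\<close> be a nonzero
  submodule. It contains a nonzero even \<open>f\<close>, because every \<open>G\<^sub>r\<close> is injective on the odd part. Up to
  a unit, \<open>G\<^sub>s G\<^sub>r f = (x + 2s\<alpha>) f(x + r + s)\<close>; varying \<open>s\<close> with \<open>r + s = n\<close> fixed shows that both
  \<open>f(x + n)\<close> and \<open>x f(x + n)\<close> are in \<open>N\<close>. Hence the even part of \<open>N\<close> is an ideal of \<open>\<complex>[x]\<close> that
  is stable under integer translations. Repeated differences \<open>f(x + 1) - f(x)\<close> lower the degree and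
  produce a nonzero constant, so the ideal is all of \<open>\<complex>[x]\<close>, and applying \<open>G\<^sub>r\<close> gives \<open>\<complex>[y]\<close>.
\<close>

lemma poly_translate_translate: "poly_translate a (poly_translate b f) = poly_translate (a + b) f"
  by (simp add: poly_translate_def poly_eq_poly_eq_iff[symmetric] poly_pcompose fun_eq_iff algebra_simps)

lemma poly_translate_zero [simp]: "poly_translate c 0 = 0"
  by (simp add: poly_translate_def)

lemma poly_translate_0 [simp]: "poly_translate 0 f = f"
  by (simp add: poly_translate_def poly_eq_poly_eq_iff[symmetric] poly_pcompose fun_eq_iff)

lemma poly_translate_eq_0_iff [simp]: "poly_translate c f = 0 \<longleftrightarrow> f = 0"
  by (simp add: poly_translate_def pcompose_eq_0_iff)

text \<open>Translation keeps the degree and the leading coefficient, so the top terms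
  cancel.\<close>

lemma degree_poly_translate_diff_less:
  assumes "degree f > 0"
  shows "degree (poly_translate c f - f) < degree f"
proof -
  have deg: "degree (poly_translate c f) = degree f"
    by (simp add: poly_translate_def degree_pcompose)
  have "lead_coeff (poly_translate c f) = lead_coeff f"
    unfolding poly_translate_def by (subst lead_coeff_comp) auto
  then have "coeff (poly_translate c f - f) (degree f) = 0"
    by (simp add: deg)
  moreover have "degree (poly_translate c f - f) \<le> degree f"
    by (rule degree_diff_le) (simp_all add: deg)
  ultimately show ?thesis
    using eq_zero_or_degree_less assms by fastforce
qed

text \<open>A 1-periodic polynomial takes the value \<open>poly f 0\<close> at every natural number,
  and a nonzero polynomial has only finitely many roots.\<close>

lemma degree_0_if_poly_translate_1_eq:
  assumes "poly_translate 1 f = f"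
  shows "degree f = 0"
proof -
  have step: "poly f (x + 1) = poly f x" for x
    using arg_cong[OF assms, of "\<lambda>p. poly p x"]
    by (simp add: poly_translate_def poly_pcompose add.commute)
  have "poly f (of_nat n) = poly f 0" for n
    by (induction n) (simp_all add: step add.commute[of 1])
  then have "range of_nat \<subseteq> {x. poly (f - [:poly f 0:]) x = 0}"
    by auto
  moreover have "infinite (range (of_nat :: nat \<Rightarrow> complex))"
    by (simp add: finite_image_iff inj_of_nat)
  ultimately have "f - [:poly f 0:] = 0"
    using poly_roots_finite finite_subset by blast
  then show ?thesis
    using degree_pCons_0[of "poly f 0"] by (simp only: right_minus_eq)
qed

text \<open>Induction on the degree: for non-constant \<open>f\<close>, the difference
  \<open>poly_translate 1 f - f\<close> stays in \<open>S\<close>, is nonzero and has smaller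
  degree.\<close>

lemma one_in_translation_stable_subspace:
  assumes diff: "\<And>p q. p \<in> S \<Longrightarrow> q \<in> S \<Longrightarrow> p - q \<in> S"
    and scale: "\<And>c p. p \<in> S \<Longrightarrow> smult c p \<in> S"
    and translate: "\<And>p. p \<in> S \<Longrightarrow> poly_translate 1 p \<in> S"
    and "f \<in> S" "f \<noteq> 0"
  shows "1 \<in> S"
  using \<open>f \<in> S\<close> \<open>f \<noteq> 0\<close>
proof (induction "degree f" arbitrary: f rule: less_induct)
  case less
  show ?case
  proof (cases "degree f = 0")
    case True
    then obtain c where c: "f = [:c:]" by (rule degree_eq_zeroE)
    with less.prems have "smult (1 / c) f = 1" by (simp add: one_pCons)
    then show ?thesis using scale[OF less.prems(1)] by metis
  next
    case False
    then have "poly_translate 1 f - f \<noteq> 0"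
      using degree_0_if_poly_translate_1_eq by auto
    with False less show ?thesis
      using degree_poly_translate_diff_less diff translate by blast
  qed
qed

lemma omega_act_in_if_gen_act_in:
  assumes "module.subspace omega_scale N" "\<And>b. omega_gen_act lam \<alpha> b v \<in> N"
  shows "omega_act lam \<alpha> a v \<in> N"
proof -
  interpret vector_space omega_scale by (rule vector_space_omega)
  show ?thesis
    unfolding omega_act_def ns_extend_def
    using assms by (intro subspace_sum subspace_scale)
qed

lemma omega_subsupermodule_alpha_0:
  "lie_subsupermodule omega_scale omega_part (omega_act lam 0) {v. poly (fst v) 0 = 0}"
proof -
  interpret vector_space omega_scale by (rule vector_space_omega)
  let ?N = "{v :: omega. poly (fst v) 0 = 0}"
  have sub: "subspace ?N"
    by (auto simp: subspace_def omega_scale_def)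
  \<comment> \<open>This holds for every \<open>v\<close>: at \<open>\<alpha> = 0\<close> each
    generator puts the factor \<open>x\<close> in front of the even component.\<close>
  have "omega_gen_act lam 0 b v \<in> ?N" for b v
    by (cases b; cases v) simp_all
  then have "omega_act lam 0 a v \<in> ?N" for a v
    by (rule omega_act_in_if_gen_act_in[OF sub])
  moreover have "\<exists>u \<in> ?N \<inter> omega_part 0. \<exists>w \<in> ?N \<inter> omega_part 1. v = u + w" if "v \<in> ?N" for v
    using that
    by (intro bexI[of _ "(fst v, 0)"] bexI[of _ "(0, snd v)"]) (auto simp: omega_part_def)
  ultimately show ?thesis
    using sub unfolding lie_subsupermodule_def by blast
qed

lemma omega_subsupermodule_eq_UNIV:
  assumes "lam \<noteq> 0" "\<alpha> \<noteq> 0"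
    and N: "lie_subsupermodule omega_scale omega_part (omega_act lam \<alpha>) N"
    and "N \<noteq> {0}"
  shows "N = UNIV"
proof -
  interpret vector_space omega_scale by (rule vector_space_omega)
  have sub: "subspace N"
    and decomp: "\<And>v. v \<in> N \<Longrightarrow> \<exists>u \<in> N \<inter> omega_part 0. \<exists>w \<in> N \<inter> omega_part 1. v = u + w"
    and act: "\<And>a v. v \<in> N \<Longrightarrow> omega_act lam \<alpha> a v \<in> N"
    using N by (simp_all add: lie_subsupermodule_def)
  have unscale: "v \<in> N" if "omega_scale c v \<in> N" "c \<noteq> 0" for c v
    using subspace_scale[OF sub that(1), of "1 / c"] that(2) by simp
  have G: "(smult (lam powi (k + 1)) ([:2 * half_int k * \<alpha>, 1:] * poly_translate (half_int k) g),
      smult (lam powi k) (poly_translate (half_int k) f)) \<in> N" if "(f, g) \<in> N" for k f g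
    using act[OF that, of "Poly_Mapping.single (NS_G k) 1"] by simp
  have G_even: "(0, poly_translate (half_int k) f) \<in> N" if "(f, 0) \<in> N" for k f
    using G[OF that, of k] \<open>lam \<noteq> 0\<close>
    by - (rule unscale[of "lam powi k"], simp_all add: omega_scale_def)
  have G_odd: "([:2 * half_int k * \<alpha>, 1:] * poly_translate (half_int k) g, 0) \<in> N"
    if "(0, g) \<in> N" for k g
    using G[OF that, of k] \<open>lam \<noteq> 0\<close>
    by - (rule unscale[of "lam powi (k + 1)"],
      simp_all add: omega_scale_def)
  \<comment> \<open>The index \<open>- k - 1\<close> stands for the half-integer opposite to
    \<open>half_int k\<close>, so the two translations cancel.\<close>
  have GG: "([:2 * half_int k * \<alpha>, 1:] * f, 0) \<in> N" if "(f, 0) \<in> N" for k f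
    using G_odd[OF G_even[OF that, of "- k - 1"], of k]
    by (simp add: poly_translate_translate half_int_def)
  \<comment> \<open>With index \<open>- k\<close> the two half-integers add up to 1.\<close>
  have GG': "([:2 * half_int k * \<alpha>, 1:] * poly_translate 1 f, 0) \<in> N" if "(f, 0) \<in> N" for k f
    using G_odd[OF G_even[OF that, of "- k"], of k]
    by (simp add: poly_translate_translate half_int_def)
  define S where "S = {f. (f, 0) \<in> N}"
  have add_S: "p + q \<in> S" if "p \<in> S" "q \<in> S" for p q
    using subspace_add[OF sub, of "(p, 0)" "(q, 0)"] that by (simp add: S_def)
  have diff_S: "p - q \<in> S" if "p \<in> S" "q \<in> S" for p q
    using subspace_diff[OF sub, of "(p, 0)" "(q, 0)"] that by (simp add: S_def)
  have scale_S: "smult c p \<in> S" if "p \<in> S" for c p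
    using subspace_scale[OF sub, of "(p, 0)" c] that by (simp add: S_def omega_scale_def)
  \<comment> \<open>Two values of \<open>k\<close> give multiples of \<open>p\<close> that differ by
    \<open>2 * \<alpha> * p\<close>; this is where \<open>\<alpha> \<noteq> 0\<close>
    enters.\<close>
  have vary: "p \<in> S" if "\<And>k. [:2 * half_int k * \<alpha>, 1:] * p \<in> S" for p
  proof -
    have "[:2 * half_int 1 * \<alpha>, 1:] * p - [:2 * half_int 0 * \<alpha>, 1:] * p = smult (2 * \<alpha>) p"
      by (simp add: half_int_def poly_eq_poly_eq_iff[symmetric] fun_eq_iff algebra_simps)
    then have "smult (1 / (2 * \<alpha>)) (smult (2 * \<alpha>) p) \<in> S"
      using diff_S[OF that[of 1] that[of 0]] scale_S by metis
    then show ?thesis using \<open>\<alpha> \<noteq> 0\<close> by simp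
  qed
  have translate_S: "poly_translate 1 f \<in> S" if "f \<in> S" for f
    by (rule vary) (use GG' that in \<open>simp add: S_def\<close>)
  \<comment> \<open>\<open>pCons 0 f\<close> is \<open>x * f\<close>, so this makes \<open>S\<close>
    an ideal.\<close>
  have pCons_S: "pCons 0 f \<in> S" if "f \<in> S" for f
  proof -
    have "[:2 * half_int 0 * \<alpha>, 1:] * f - smult (2 * half_int 0 * \<alpha>) f = pCons 0 f"
      by simp
    moreover have "[:2 * half_int 0 * \<alpha>, 1:] * f \<in> S"
      using GG that unfolding S_def by blast
    ultimately show ?thesis
      using diff_S scale_S[OF that] by metis
  qed
  have "0 \<in> N" by (rule subspace_0[OF sub])
  with \<open>N \<noteq> {0}\<close> obtain v where v: "v \<in> N" "v \<noteq> 0" by blast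
  from decomp[OF v(1)] obtain f g where fg: "(f, 0) \<in> N" "(0, g) \<in> N" "v = (f, g)"
    by (auto simp: omega_part_def)
  have "\<exists>p \<in> S. p \<noteq> 0"
  proof (cases "f = 0")
    case True
    \<comment> \<open>Here \<open>g\<close> is nonzero, and neither the translation nor the monic
      linear factor can kill it.\<close>
    then have "[:2 * half_int 0 * \<alpha>, 1:] * poly_translate (half_int 0) g \<noteq> 0"
      using v fg by (simp add: zero_prod_def del: mult_pCons_left)
    then show ?thesis using G_odd[OF fg(2), of 0] unfolding S_def by blast
  next
    case False
    then show ?thesis using fg(1) by (auto simp: S_def)
  qed
  then have one: "1 \<in> S"
    using one_in_translation_stable_subspace[of S] diff_S scale_S translate_S by blast
  have all_S: "p \<in> S" for p
  proof (induction p)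
    case 0
    show ?case using scale_S[OF one, of 0] by simp
  next
    case (pCons a p)
    have "pCons a p = smult a 1 + pCons 0 p" by (simp add: one_pCons)
    then show ?case using add_S[OF scale_S[OF one] pCons_S[OF pCons.IH]] by metis
  qed
  have "(p, q) \<in> N" for p q
  proof -
    \<comment> \<open>Translating \<open>q\<close> back by 1/2 gives an even element that
      \<open>G\<close> with \<open>r = 1/2\<close> sends to a nonzero multiple of
      \<open>q\<close>.\<close>
    have "(0, q) \<in> N"
      using G_even[of "poly_translate (- half_int 0) q" 0] all_S
      by (simp add: S_def poly_translate_translate)
    moreover have "(p, 0) \<in> N" using all_S by (simp add: S_def)
    ultimately show ?thesis
      using subspace_add[OF sub, of "(p, 0)" "(0, q)"] by simp
  qed
  then show ?thesis by auto
qed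

theorem corollary2p12:
  fixes lam \<alpha> :: complex
  assumes "lam \<noteq> 0"
  shows "simple_lie_supermodule ns_scale ns_part ns_bracket
           omega_scale omega_part (omega_act lam \<alpha>) \<longleftrightarrow> \<alpha> \<noteq> 0"
proof
  assume simple: "simple_lie_supermodule ns_scale ns_part ns_bracket
    omega_scale omega_part (omega_act lam \<alpha>)"
  show "\<alpha> \<noteq> 0"
  proof
    assume "\<alpha> = 0"
    then have "{v :: omega. poly (fst v) 0 = 0} = {0} \<or> {v :: omega. poly (fst v) 0 = 0} = UNIV"
      using simple omega_subsupermodule_alpha_0[of lam] unfolding simple_lie_supermodule_def by blast
    \<comment> \<open>\<open>(0, 1)\<close> shows that the submodule is nonzero,
      \<open>(1, 0)\<close> that it is proper.\<close>
    moreover have "(0, 1) \<in> {v :: omega. poly (fst v) 0 = 0}" "(0, 1) \<noteq> (0 :: omega)"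
      "(1, 0) \<notin> {v :: omega. poly (fst v) 0 = 0}"
      by (simp_all add: zero_prod_def)
    ultimately show False by blast
  qed
next
  assume "\<alpha> \<noteq> 0"
  moreover have "\<exists>v :: omega. v \<noteq> 0"
    by (rule exI[of _ "(1, 0)"]) (simp add: zero_prod_def)
  ultimately show "simple_lie_supermodule ns_scale ns_part ns_bracket
    omega_scale omega_part (omega_act lam \<alpha>)"
    using lie_supermodule_omega[OF assms] omega_subsupermodule_eq_UNIV[OF assms]
    unfolding simple_lie_supermodule_def by blast
qed

end
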